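(* Let $p\geq 2$ and let $\alpha\in\mathbb{N}$ (a positive integer) be fixed. Then there exists $N=N(\alpha,p)$, depending only on $p$ and $\alpha$, such that for all $n\geq N$, writing $k=n-\alpha$, \[ A(p,n,k)^2\geq A(p,n,k-1)\,A(p,n,k+1). \]
   Context: For $n\in\mathbb{N}$ let $S_n$ be the symmetric group on $[n]=\{1,\dots,n\}$. For $p,n\in\mathbb{N}$ let $\mathcal{C}_{p,n}=\{(\sigma_1,\dots,\sigma_p)\in (S_n)^p:\ \sigma_i\sigma_j=\sigma_j\sigma_i \text{ for all } i,j\in[p]\}$ be the set of commuting $p$-tuples of permutations of $[n]$. For $\boldsymbol\sigma\in\mathcal{C}_{p,n}$, let $\langle\boldsymbol\sigma\rangle$ be the subgroup of $S_n$ generated by $\sigma_1,\dots,\sigma_p$. For $1\le k\le n$, $A(p,n,k)$ denotes the number of $\boldsymbol\sigma\in\mathcal{C}_{p,n}$ such that the action of $\langle\boldsymbol\sigma\rangle$ on $[n]$ has exactly $k$ orbits. *)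

theory Defs
  imports
    "HOL-Algebra.Sym_Groups"
    "HOL-Algebra.Generated_Groups"
    "HOL-Algebra.Group_Action"
begin

text \<open>A \<open>p\<close>-tuple of permutations is a list of length \<open>p\<close>.\<close>

definition commuting_tuples :: "nat \<Rightarrow> nat \<Rightarrow> (nat \<Rightarrow> nat) list set"
  where "commuting_tuples p n =
    {\<sigma>. length \<sigma> = p \<and> set \<sigma> \<subseteq> carrier (sym_group n) \<and>
        (\<forall>i<p. \<forall>j<p. \<sigma> ! i \<otimes>\<^bsub>sym_group n\<^esub> \<sigma> ! j = \<sigma> ! j \<otimes>\<^bsub>sym_group n\<^esub> \<sigma> ! i)}"

definition generated_subgroup :: "nat \<Rightarrow> (nat \<Rightarrow> nat) list \<Rightarrow> (nat \<Rightarrow> nat) monoid"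
  where "generated_subgroup n \<sigma> =
    (sym_group n) \<lparr> carrier := generate (sym_group n) (set \<sigma>) \<rparr>"

text \<open>The action is the natural one, \<open>g \<cdot> x = g x\<close>, restricted to \<open>{1..n}\<close>
  because \<^const>\<open>BijGroup\<close> consists of extensional functions.\<close>

definition commuting_orbit_count :: "nat \<Rightarrow> nat \<Rightarrow> nat \<Rightarrow> nat"
  where "commuting_orbit_count p n k = card {\<sigma> \<in> commuting_tuples p n.
    card (orbits (generated_subgroup n \<sigma>) {1..n} (\<lambda>g. restrict g {1..n})) = k}"

end

theory Submission
  imports Defs Complex_Main
begin

text \<open>
  Splitting a commuting tuple along the orbit of the point \<open>n + 1\<close> gives
  \<open>A(n + 1, k + 1) = (\<Sum>r\<le>n. C(n, r) A(r + 1, 1) A(n - r, k))\<close>. For \<open>D\<^sub>a(n) = A(n, n - a)\<close> this reads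
  \<open>D\<^sub>a(n + 1) - D\<^sub>a(n) = (\<Sum>r=1..a. C(n, r) A(r + 1, 1) D\<^bsub>a-r\<^esub>(n - r))\<close>, where the term \<open>r = 1\<close>
  dominates. By induction on \<open>a\<close> and the Stolz--Cesaro theorem, \<open>D\<^sub>a(n) / n\<^bsup>2a\<^esup>\<close> tends to
  \<open>c\<^sup>a / a!\<close> with \<open>c = A(2, 1) / 2 > 0\<close>. These limits are strictly log-concave in \<open>a\<close>, so
  the inequality even holds strictly for large \<open>n\<close>.
\<close>

subsection \<open>Orbits and restriction to invariant sets\<close>

text \<open>Only forward images are taken: for permutations of a finite set the closure under
  inverses is automatic.\<close>

inductive_set orb :: "('a \<Rightarrow> 'a) set \<Rightarrow> 'a \<Rightarrow> 'a set" for F x where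
  self: "x \<in> orb F x"
| step: "y \<in> orb F x \<Longrightarrow> s \<in> F \<Longrightarrow> s y \<in> orb F x"

lemma orb_least:
  assumes "x \<in> S" "\<And>s y. s \<in> F \<Longrightarrow> y \<in> S \<Longrightarrow> s y \<in> S"
  shows "orb F x \<subseteq> S"
proof
  fix y assume "y \<in> orb F x"
  then show "y \<in> S" by induction (use assms in auto)
qed

lemma orb_trans: "y \<in> orb F x \<Longrightarrow> orb F y \<subseteq> orb F x"
  by (rule orb_least) (auto intro: orb.step)

lemma orb_subset:
  assumes "\<And>s. s \<in> F \<Longrightarrow> s permutes X" "x \<in> X"
  shows "orb F x \<subseteq> X"
  using assms by (intro orb_least) (auto simp: permutes_in_image)

text \<open>A step stays in the orbit, and an injective self-map of a finite set is onto. This is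
  what lets forward orbits replace group orbits: preimages under \<open>s\<close> stay in the orbit
  too.\<close>

lemma image_orb:
  assumes "finite X" "\<And>s. s \<in> F \<Longrightarrow> s permutes X" "x \<in> X" "s \<in> F"
  shows "s ` orb F x = orb F x"
proof (rule card_subset_eq)
  have "inj_on s (orb F x)" using assms by (meson inj_on_subset permutes_inj subset_UNIV)
  then show "card (s ` orb F x) = card (orb F x)" by (rule card_image)
  show "finite (orb F x)" using orb_subset[of F X x] assms finite_subset by blast
qed (use assms in \<open>auto intro: orb.step\<close>)

lemma orb_sym:
  assumes X: "finite X" "\<And>s. s \<in> F \<Longrightarrow> s permutes X" "x \<in> X" and "y \<in> orb F x"
  shows "x \<in> orb F y"
  using assms(4)
proof induction
  case (step y s)
  have "s y \<in> X" using orb_subset[of F X x] X step by (meson orb.step subsetD)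
  \<comment> \<open>A step is undone without inverses: \<open>s y\<close> has a preimage under
    \<open>s\<close> inside its own orbit, and by injectivity that preimage is
    \<open>y\<close>.\<close>
  then have "s ` orb F (s y) = orb F (s y)" using X step by (intro image_orb) auto
  then have "s y \<in> s ` orb F (s y)" by (simp add: orb.self)
  then have "y \<in> orb F (s y)" using X(2)[OF step(2)] by (simp add: inj_image_mem_iff permutes_inj)
  then show ?case using orb_trans step.IH by fast
qed (rule orb.self)

lemma orb_eq:
  assumes "finite X" "\<And>s. s \<in> F \<Longrightarrow> s permutes X" "x \<in> X" "y \<in> orb F x"
  shows "orb F y = orb F x"
proof (rule subset_antisym)
  have "x \<in> orb F y" by (rule orb_sym) (use assms in auto)
  then show "orb F x \<subseteq> orb F y" by (rule orb_trans)
  show "orb F y \<subseteq> orb F x" using assms(4) by (rule orb_trans)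
qed

text \<open>Extending by the identity, rather than by \<open>undefined\<close>, keeps restrictions
  within the \<open>permutes\<close> predicate and lets them be recombined by composition.\<close>

definition restr :: "'a set \<Rightarrow> ('a \<Rightarrow> 'a) \<Rightarrow> 'a \<Rightarrow> 'a"
  where "restr S f x = (if x \<in> S then f x else x)"

text \<open>An orbit that starts in an invariant set never leaves it, and there the restricted maps
  agree with the original ones.\<close>

lemma orb_restr:
  assumes "\<And>s. s \<in> F \<Longrightarrow> s ` S \<subseteq> S" "x \<in> S"
  shows "orb (restr S ` F) x = orb F x"
proof
  have S: "orb F x \<subseteq> S" using assms by (intro orb_least) auto
  show "orb (restr S ` F) x \<subseteq> orb F x"
    by (rule orb_least) (use S in \<open>auto simp: restr_def intro: orb.intros\<close>)
  show "orb F x \<subseteq> orb (restr S ` F) x"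
  proof
    fix y assume "y \<in> orb F x"
    then show "y \<in> orb (restr S ` F) x"
    proof induction
      case (step y s)
      then have "restr S s y \<in> orb (restr S ` F) x"
        using orb.step[of y "restr S ` F" x "restr S s"] by auto
      moreover have "y \<in> S" using S step by auto
      ultimately show ?case by (simp add: restr_def[of S s y])
    qed (rule orb.self)
  qed
qed

lemma permutes_restr:
  assumes "finite S" "s permutes X" "s ` S \<subseteq> S"
  shows "restr S s permutes S"
proof (rule bij_imp_permutes)
  have inj: "inj_on s S" using assms by (meson inj_on_subset permutes_inj subset_UNIV)
  then have "bij_betw s S S" using assms by (simp add: bij_betw_def endo_inj_surj)
  then show "bij_betw (restr S s) S S" by (subst bij_betw_cong[of _ _ s]) (auto simp: restr_def)
qed (auto simp: restr_def)

lemma invariant_diff: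
  assumes "finite S" "s permutes X" "s ` S \<subseteq> S"
  shows "s ` (X - S) \<subseteq> X - S"
proof -
  have "inj s" using assms by (meson permutes_inj)
  moreover have "s ` S = S" using assms \<open>inj s\<close> by (meson endo_inj_surj inj_on_subset subset_UNIV)
  moreover have "s ` X = X" using assms by (simp add: permutes_image)
  ultimately show ?thesis by (simp add: image_set_diff)
qed

text \<open>The two pieces act on disjoint sets, so each point is moved by at most one of them;
  outside \<open>X\<close> the permutation is trivial anyway.\<close>

lemma restr_comp_restr:
  assumes "s permutes X" "s ` (X - S) \<subseteq> X - S"
  shows "restr S s \<circ> restr (X - S) s = s"
proof
  fix x
  show "(restr S s \<circ> restr (X - S) s) x = s x"
    using assms by (cases "x \<in> X") (auto simp: restr_def permutes_not_in image_subset_iff)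
qed

lemma restr_comp:
  assumes "t ` S \<subseteq> S"
  shows "restr S s \<circ> restr S t = restr S (s \<circ> t)"
  using assms by (auto simp: restr_def fun_eq_iff)

text \<open>The converse of the decomposition: permutations with disjoint supports can be read off
  from their composition.\<close>

lemma restr_glue:
  assumes "f permutes S" "g permutes T" "S \<inter> T = {}"
  shows "restr S (f \<circ> g) = f" "restr T (f \<circ> g) = g"
proof -
  have "g x = x" if "x \<in> S" for x using that assms by (metis IntI emptyE permutes_not_in)
  moreover have "f x = x" if "x \<in> T" for x using that assms by (metis IntI emptyE permutes_not_in)
  moreover have "g x \<in> T" if "x \<in> T" for x using that assms by (simp add: permutes_in_image)
  ultimately show "restr S (f \<circ> g) = f" "restr T (f \<circ> g) = g"
    using assms by (auto simp: restr_def fun_eq_iff permutes_not_in)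
qed

text \<open>No orbit meets both an invariant set and its complement, so the orbit counts of the two
  parts add up.\<close>

lemma card_orbs_split:
  assumes "finite X" "S \<subseteq> X" "\<And>s. s \<in> F \<Longrightarrow> s permutes X" "\<And>s. s \<in> F \<Longrightarrow> s ` S \<subseteq> S"
  shows "card (orb F ` X) = card (orb (restr S ` F) ` S) + card (orb (restr (X - S) ` F) ` (X - S))"
proof -
  have S: "finite S" using assms finite_subset by auto
  have inv: "s ` (X - S) \<subseteq> X - S" if "s \<in> F" for s
    using invariant_diff[OF S] that assms by simp
  have 1: "orb F ` S = orb (restr S ` F) ` S"
    using orb_restr[of F S] assms by (intro image_cong) auto
  have 2: "orb F ` (X - S) = orb (restr (X - S) ` F) ` (X - S)"
    using orb_restr[of F "X - S"] inv by (intro image_cong) auto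
  have "orb F x \<noteq> orb F y" if "x \<in> S" "y \<in> X - S" for x y
  proof -
    have "orb F x \<subseteq> S" using assms(4) that by (intro orb_least) (auto simp: image_subset_iff)
    then show ?thesis using orb.self[of y F] that by auto
  qed
  then have "orb F ` S \<inter> orb F ` (X - S) = {}" by auto
  moreover have "orb F ` X = orb F ` S \<union> orb F ` (X - S)" using assms(2) by auto
  ultimately have "card (orb F ` X) = card (orb F ` S) + card (orb F ` (X - S))"
    using assms(1) S by (simp add: card_Un_disjoint)
  then show ?thesis by (simp add: 1 2)
qed

subsection \<open>Splitting off an orbit\<close>

text \<open>The ground set is arbitrary because removing an orbit from an interval does not leave an
  interval. Commutation is stated on entries instead of indices, which suits images under
  \<open>restr\<close>.\<close>

definition tuples :: "nat \<Rightarrow> 'a set \<Rightarrow> nat \<Rightarrow> ('a \<Rightarrow> 'a) list set"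
  where "tuples p X k = {\<sigma>. length \<sigma> = p \<and> (\<forall>s\<in>set \<sigma>. s permutes X) \<and>
    (\<forall>s\<in>set \<sigma>. \<forall>t\<in>set \<sigma>. s \<circ> t = t \<circ> s) \<and> card (orb (set \<sigma>) ` X) = k}"

lemma finite_tuples: "finite X \<Longrightarrow> finite (tuples p X k)"
  by (rule finite_subset[OF _ finite_lists_length_eq[OF finite_permutations, of X p]])
    (auto simp: tuples_def)

text \<open>Transitivity may be tested at a single point, since orbits of points in a common orbit
  coincide.\<close>

lemma card_orbs_eq_1_iff:
  assumes "finite X" "\<And>s. s \<in> F \<Longrightarrow> s permutes X" "a \<in> X"
  shows "card (orb F ` X) = 1 \<longleftrightarrow> orb F a = X"
proof
  assume "card (orb F ` X) = 1"
  then obtain Z where "orb F ` X = {Z}" by (auto simp: card_1_singleton_iff)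
  then have "orb F y = orb F a" if "y \<in> X" for y
    using that assms(3) by (metis imageI singletonD)
  then have "y \<in> orb F a" if "y \<in> X" for y using that orb.self[of y F] by simp
  moreover have "orb F a \<subseteq> X" using assms(2,3) by (rule orb_subset)
  ultimately show "orb F a = X" by auto
next
  assume *: "orb F a = X"
  have "orb F y = X" if "y \<in> X" for y
  proof -
    have "y \<in> orb F a" using * that by simp
    then have "orb F y = orb F a" using assms by (intro orb_eq[of X]) auto
    then show ?thesis using * by simp
  qed
  then have "orb F ` X = {X}" using assms(3) by auto
  then show "card (orb F ` X) = 1" by simp
qed

text \<open>Once the orbit \<open>S\<close> of \<open>a\<close> is fixed, a tuple amounts to a
  transitive tuple on \<open>S\<close> and an independent tuple on the complement with one orbit
  fewer. Disjoint supports make the two parts commute, so any pair can be glued.\<close>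

lemma bij_betw_restr_tuples:
  assumes X: "finite X" "S \<subseteq> X" and a: "a \<in> S"
  shows "bij_betw (\<lambda>\<sigma>. (map (restr S) \<sigma>, map (restr (X - S)) \<sigma>))
    {\<sigma> \<in> tuples p X (Suc k). orb (set \<sigma>) a = S} (tuples p S 1 \<times> tuples p (X - S) k)"
proof (rule bij_betw_byWitness[where f' = "\<lambda>(\<tau>, \<rho>). map2 (\<circ>) \<tau> \<rho>"])
  have S: "finite S" using X finite_subset by auto
  have inv: "s ` S \<subseteq> S" "s ` (X - S) \<subseteq> X - S" "s permutes X" 
    if "\<sigma> \<in> tuples p X (Suc k)" "orb (set \<sigma>) a = S" "s \<in> set \<sigma>" for \<sigma> s
  \<comment> \<open>Being an orbit, \<open>S\<close> is invariant under every entry; finiteness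
    passes this on to the complement.\<close>
  proof -
    show "s permutes X" using that by (auto simp: tuples_def)
    show "s ` S \<subseteq> S" using orb.step[of _ "set \<sigma>" a s] that by auto
    then show "s ` (X - S) \<subseteq> X - S" using invariant_diff[OF S \<open>s permutes X\<close>] by auto
  qed
  show "\<forall>\<sigma>\<in>{\<sigma> \<in> tuples p X (Suc k). orb (set \<sigma>) a = S}.
      (case (map (restr S) \<sigma>, map (restr (X - S)) \<sigma>) of (\<tau>, \<rho>) \<Rightarrow> map2 (\<circ>) \<tau> \<rho>) = \<sigma>"
  proof safe
    fix \<sigma> assume \<sigma>: "\<sigma> \<in> tuples p X (Suc k)" "S = orb (set \<sigma>) a"
    have "map2 (\<circ>) (map (restr S) \<sigma>) (map (restr (X - S)) \<sigma>)
        = map (\<lambda>s. restr S s \<circ> restr (X - S) s) \<sigma>"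
      by (intro nth_equalityI) auto
    also have "\<dots> = \<sigma>" using inv[OF \<sigma>(1) \<sigma>(2)[symmetric]] by (intro map_idI restr_comp_restr) auto
    finally show "map2 (\<circ>) (map (restr (orb (set \<sigma>) a)) \<sigma>) (map (restr (X - orb (set \<sigma>) a)) \<sigma>) = \<sigma>"
      using \<sigma> by simp
  qed
  have glue: "map (restr S) (map2 (\<circ>) \<tau> \<rho>) = \<tau>" "map (restr (X - S)) (map2 (\<circ>) \<tau> \<rho>) = \<rho>"
    if "\<tau> \<in> tuples p S 1" "\<rho> \<in> tuples p (X - S) k" for \<tau> \<rho>
    using that by (auto simp: tuples_def intro!: nth_equalityI restr_glue[where S = S and T = "X - S"])
  then show "\<forall>\<tau>\<rho>\<in>tuples p S 1 \<times> tuples p (X - S) k.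
      (map (restr S) (case \<tau>\<rho> of (\<tau>, \<rho>) \<Rightarrow> map2 (\<circ>) \<tau> \<rho>),
       map (restr (X - S)) (case \<tau>\<rho> of (\<tau>, \<rho>) \<Rightarrow> map2 (\<circ>) \<tau> \<rho>)) = \<tau>\<rho>"
    by auto
  have "map (restr S) \<sigma> \<in> tuples p S 1 \<and> map (restr (X - S)) \<sigma> \<in> tuples p (X - S) k"
    if \<sigma>: "\<sigma> \<in> tuples p X (Suc k)" "orb (set \<sigma>) a = S" for \<sigma>
  proof -
    note inv = inv[OF \<sigma>]
    have perm: "restr S s permutes S" "restr (X - S) s permutes (X - S)" if "s \<in> set \<sigma>" for s
      using inv[OF that] X S by (auto intro: permutes_restr[of _ s X])
    have comm: "restr Y s \<circ> restr Y t = restr Y t \<circ> restr Y s"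
      if "s \<in> set \<sigma>" "t \<in> set \<sigma>" "Y = S \<or> Y = X - S" for s t Y
    proof -
      have "s \<circ> t = t \<circ> s" using that \<sigma> by (auto simp: tuples_def)
      then show ?thesis using that inv[of s] inv[of t] by (auto simp: restr_comp)
    qed
    \<comment> \<open>The restricted tuple is transitive on \<open>S\<close>, so it accounts for
      exactly one of the \<open>Suc k\<close> orbits.\<close>
    have "orb (restr S ` set \<sigma>) a = S" using orb_restr[of "set \<sigma>" S a] inv a \<sigma> by auto
    then have 1: "card (orb (restr S ` set \<sigma>) ` S) = 1"
      using card_orbs_eq_1_iff[of S "restr S ` set \<sigma>" a] S a perm by auto
    have "card (orb (set \<sigma>) ` X) = Suc k" using \<sigma> by (simp add: tuples_def)
    then have "card (orb (restr (X - S) ` set \<sigma>) ` (X - S)) = k"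
      using card_orbs_split[of X S "set \<sigma>"] X inv 1 by auto
    then show ?thesis using 1 perm comm \<sigma> by (auto simp: tuples_def)
  qed
  then show "(\<lambda>\<sigma>. (map (restr S) \<sigma>, map (restr (X - S)) \<sigma>)) `
      {\<sigma> \<in> tuples p X (Suc k). orb (set \<sigma>) a = S} \<subseteq> tuples p S 1 \<times> tuples p (X - S) k"
    by blast
  have "map2 (\<circ>) \<tau> \<rho> \<in> tuples p X (Suc k) \<and> orb (set (map2 (\<circ>) \<tau> \<rho>)) a = S"
    if \<tau>: "\<tau> \<in> tuples p S 1" and \<rho>: "\<rho> \<in> tuples p (X - S) k" for \<tau> \<rho>
  proof -
    define \<sigma> where "\<sigma> = map2 (\<circ>) \<tau> \<rho>"
    have g: "map (restr S) \<sigma> = \<tau>" "map (restr (X - S)) \<sigma> = \<rho>"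
      using glue[OF that] by (auto simp: \<sigma>_def)
    then have gs: "restr S ` set \<sigma> = set \<tau>" "restr (X - S) ` set \<sigma> = set \<rho>"
      by (metis list.set_map)+
    have perm: "s permutes X" "s ` S \<subseteq> S" if s_in: "s \<in> set \<sigma>" for s
    proof -
      obtain f g where "s = f \<circ> g" "(f, g) \<in> set (zip \<tau> \<rho>)"
        using s_in by (auto simp: \<sigma>_def)
      then have s: "s = f \<circ> g" "f \<in> set \<tau>" "g \<in> set \<rho>"
        by (auto dest: set_zip_leftD set_zip_rightD)
      then have fg: "f permutes S" "g permutes (X - S)" using \<tau> \<rho> by (auto simp: tuples_def)
      then show "s permutes X"
        using s X by (metis Diff_subset permutes_compose permutes_subset)
      show "s ` S \<subseteq> S"
        by (auto simp: s permutes_not_in[OF fg(2)] permutes_in_image[OF fg(1)])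
    qed
    have perm': "s ` (X - S) \<subseteq> X - S" if "s \<in> set \<sigma>" for s
      using invariant_diff[OF S] perm[OF that] by auto
    \<comment> \<open>Both products preserve \<open>X - S\<close> and are thus determined by their
      two restrictions, where commutation is inherited from \<open>\<tau>\<close> and
      \<open>\<rho>\<close>.\<close>
    have comm: "s \<circ> t = t \<circ> s" if "s \<in> set \<sigma>" "t \<in> set \<sigma>" for s t
    proof -
      have eq: "restr S (s \<circ> t) = restr S (t \<circ> s)" "restr (X - S) (s \<circ> t) = restr (X - S) (t \<circ> s)"
      proof -
        have "restr S s \<circ> restr S t = restr S t \<circ> restr S s"
          using \<tau> imageI[of _ "set \<sigma>" "restr S", unfolded gs(1)] that
          by (simp add: tuples_def)
        then show "restr S (s \<circ> t) = restr S (t \<circ> s)" using that perm by (simp add: restr_comp)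
        have "restr (X - S) s \<circ> restr (X - S) t = restr (X - S) t \<circ> restr (X - S) s"
          using \<rho> imageI[of _ "set \<sigma>" "restr (X - S)", unfolded gs(2)] that
          by (simp add: tuples_def)
        then show "restr (X - S) (s \<circ> t) = restr (X - S) (t \<circ> s)"
          using that perm' by (simp add: restr_comp)
      qed
      have "(s \<circ> t) permutes X" "(t \<circ> s) permutes X"
        using that perm permutes_compose by blast+
      moreover have "(s \<circ> t) ` (X - S) \<subseteq> X - S" "(t \<circ> s) ` (X - S) \<subseteq> X - S"
        using perm'[OF that(1)] perm'[OF that(2)] by (auto simp: image_subset_iff)
      ultimately show ?thesis using restr_comp_restr eq by metis
    qed
    have "card (orb (set \<sigma>) ` X) = Suc k"
      using card_orbs_split[of X S "set \<sigma>"] X perm gs \<tau> \<rho> by (simp add: tuples_def)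
    moreover have "length \<sigma> = p" using \<tau> \<rho> by (simp add: \<sigma>_def tuples_def)
    ultimately have "\<sigma> \<in> tuples p X (Suc k)" using perm comm by (auto simp: tuples_def)
    moreover have "orb (set \<tau>) a = S"
      using card_orbs_eq_1_iff[of S "set \<tau>" a] S \<tau> a by (auto simp: tuples_def)
    then have "orb (set \<sigma>) a = S" using orb_restr[of "set \<sigma>" S a] perm a gs by auto
    ultimately show ?thesis by (simp add: \<sigma>_def)
  qed
  then show "(\<lambda>(\<tau>, \<rho>). map2 (\<circ>) \<tau> \<rho>) ` (tuples p S 1 \<times> tuples p (X - S) k)
      \<subseteq> {\<sigma> \<in> tuples p X (Suc k). orb (set \<sigma>) a = S}"
    by (simp only: image_subset_iff Ball_def split_paired_All mem_Times_iff fst_conv snd_conv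
        prod.case mem_Collect_eq) blast
qed

text \<open>The tuples are classified by the orbit of the marked point \<open>a\<close>; each class
  is counted by the bijection above.\<close>

lemma card_tuples_Suc:
  assumes "finite X" "a \<in> X"
  shows "card (tuples p X (Suc k)) =
    (\<Sum>S | a \<in> S \<and> S \<subseteq> X. card (tuples p S 1) * card (tuples p (X - S) k))"
proof -
  have "tuples p X (Suc k) = (\<Union>S\<in>{S. a \<in> S \<and> S \<subseteq> X}. {\<sigma> \<in> tuples p X (Suc k). orb (set \<sigma>) a = S})"
    using orb_subset[of "set _" X a] assms(2) by (auto simp: tuples_def intro: orb.self)
  also have "card \<dots> = (\<Sum>S | a \<in> S \<and> S \<subseteq> X. card {\<sigma> \<in> tuples p X (Suc k). orb (set \<sigma>) a = S})"
    using assms by (intro card_UN_disjoint) (auto simp: finite_tuples)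
  also have "\<dots> = (\<Sum>S | a \<in> S \<and> S \<subseteq> X. card (tuples p S 1) * card (tuples p (X - S) k))"
  proof (intro sum.cong refl)
    fix S assume "S \<in> {S. a \<in> S \<and> S \<subseteq> X}"
    then show "card {\<sigma> \<in> tuples p X (Suc k). orb (set \<sigma>) a = S} =
        card (tuples p S 1) * card (tuples p (X - S) k)"
      using bij_betw_same_card[OF bij_betw_restr_tuples[OF assms(1), of S a p k]]
      by (simp add: card_cartesian_product)
  qed
  finally show ?thesis .
qed

section \<open>Invariance under relabelling of the points\<close>

lemma permutes_conj:
  assumes "bij h" "s permutes X"
  shows "(h \<circ> s \<circ> inv' h) permutes (h ` X)"
proof (rule bij_imp_permutes)
  have "(h \<circ> s \<circ> inv' h) ` h ` X = h ` X"
    using assms(1) permutes_image[OF assms(2)] by (metis bij_is_inj image_comp image_inv_f_f)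
  moreover have "bij (h \<circ> s \<circ> inv' h)"
    using assms by (intro bij_comp bij_imp_bij_inv) (auto simp: permutes_bij)
  ultimately show "bij_betw (h \<circ> s \<circ> inv' h) (h ` X) (h ` X)"
    by (metis bij_betw_def inj_on_subset subset_UNIV)
next
  fix x assume "x \<notin> h ` X"
  then have "inv' h x \<notin> X" using assms by (metis bij_inv_eq_iff imageI)
  then show "(h \<circ> s \<circ> inv' h) x = x" using assms by (simp add: permutes_not_in bij_is_surj surj_f_inv_f)
qed

lemma orb_conj:
  assumes "bij h"
  shows "orb ((\<lambda>s. h \<circ> s \<circ> inv' h) ` F) (h x) = h ` orb F x"
proof
  have [simp]: "inv' h (h y) = y" for y using assms by (simp add: bij_is_inj)
  show "orb ((\<lambda>s. h \<circ> s \<circ> inv' h) ` F) (h x) \<subseteq> h ` orb F x"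
    by (rule orb_least) (auto intro: orb.intros)
  have "h y \<in> orb ((\<lambda>s. h \<circ> s \<circ> inv' h) ` F) (h x)" if "y \<in> orb F x" for y
    using that
  proof induction
    case (step y s)
    let ?G = "(\<lambda>s. h \<circ> s \<circ> inv' h) ` F"
    have "(h \<circ> s \<circ> inv' h) (h y) \<in> orb ?G (h x)"
      using step orb.step[of "h y" ?G "h x"] by blast
    moreover have "(h \<circ> s \<circ> inv' h) (h y) = h (s y)" by simp
    ultimately show ?case by metis
  qed (rule orb.self)
  then show "h ` orb F x \<subseteq> orb ((\<lambda>s. h \<circ> s \<circ> inv' h) ` F) (h x)" by auto
qed

text \<open>Conjugation by \<open>h\<close> is injective, respects composition and carries orbits to
  orbits. An inequality suffices, since equality follows by exchanging the two sets.\<close>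

lemma card_tuples_image_le:
  assumes "bij h" "finite X"
  shows "card (tuples p X k) \<le> card (tuples p (h ` X) k)"
proof (rule card_inj_on_le)
  let ?c = "\<lambda>s. h \<circ> s \<circ> inv' h"
  have [simp]: "inv' h (h y) = y" for y using assms by (simp add: bij_is_inj)
  have "s = t" if "?c s = ?c t" for s t
  proof
    fix x
    have "?c s (h x) = ?c t (h x)" using that by simp
    then show "s x = t x" using assms(1) by (simp add: bij_is_inj inj_eq)
  qed
  then have "inj ?c" by (auto intro: injI)
  then show "inj_on (map ?c) (tuples p X k)" by (meson inj_mapI inj_on_subset subset_UNIV)
  have "orb (?c ` F) ` (h ` X) = image h ` (orb F ` X)" for F
    by (simp add: image_image orb_conj[OF assms(1)])
  moreover have "card (image h ` Z) = card Z" for Z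
    using assms(1) by (intro card_image inj_onI) (simp add: bij_is_inj inj_image_eq_iff)
  ultimately have "card (orb (?c ` F) ` (h ` X)) = card (orb F ` X)" for F by simp
  moreover have "?c s \<circ> ?c t = ?c (s \<circ> t)" for s t by auto
  ultimately show "map ?c ` tuples p X k \<subseteq> tuples p (h ` X) k"
    using permutes_conj[OF assms(1)] by (auto simp: tuples_def)
  show "finite (tuples p (h ` X) k)" using assms finite_tuples by blast
qed

text \<open>Conjugation needs a bijection of the whole type. As \<open>X\<close> and
  \<open>Y\<close> may overlap, a bijection from \<open>X\<close> to \<open>Y\<close> is completed
  by one from \<open>Y - X\<close> to \<open>X - Y\<close> and by the identity elsewhere.\<close>

lemma ex_bij_image_eq:
  fixes X Y :: "'a set"
  assumes "finite X" "finite Y" "card X = card Y"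
  shows "\<exists>h. bij h \<and> h ` X = Y"
proof -
  obtain f where f: "bij_betw f X Y" using assms finite_same_card_bij by blast
  have "card (Y - X) = card (X - Y)" using assms by (simp add: card_le_sym_Diff card_Diff_subset_Int Int_commute)
  then obtain g where g: "bij_betw g (Y - X) (X - Y)" using assms finite_same_card_bij by (metis finite_Diff)
  define h where "h = (\<lambda>x. if x \<in> X then f x else if x \<in> Y - X then g x else x)"
  have 1: "bij_betw h X Y" using f by (subst bij_betw_cong[of _ _ f]) (auto simp: h_def)
  have 2: "bij_betw h (Y - X) (X - Y)" using g by (subst bij_betw_cong[of _ _ g]) (auto simp: h_def)
  have 3: "bij_betw h (- (X \<union> Y)) (- (X \<union> Y))"
    by (subst bij_betw_cong[of _ _ id]) (auto simp: h_def)
  have "bij_betw h (X \<union> (Y - X) \<union> - (X \<union> Y)) (Y \<union> (X - Y) \<union> - (X \<union> Y))"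
    by (intro bij_betw_combine 1 2 3) auto
  moreover have "X \<union> (Y - X) \<union> - (X \<union> Y) = UNIV" "Y \<union> (X - Y) \<union> - (X \<union> Y) = UNIV" by auto
  ultimately have "bij h" by metis
  with 1 show ?thesis by (auto simp: bij_betw_def)
qed

lemma card_tuples_cong:
  fixes X Y :: "'a set"
  assumes "finite X" "finite Y" "card X = card Y"
  shows "card (tuples p X k) = card (tuples p Y k)"
proof -
  have "card (tuples p X k) \<le> card (tuples p Y k)"
    if "finite X" "finite Y" "card X = card Y" for X Y :: "'a set"
    using ex_bij_image_eq[OF that] card_tuples_image_le that by metis
  from this[of X Y] this[of Y X] show ?thesis using assms by simp
qed

section \<open>Agreement with the orbits of the generated subgroup\<close>

text \<open>Forward words in the generators lie in the subgroup. Conversely, induction over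
  \<open>generate\<close> shows that no element of the subgroup leaves a forward orbit.\<close>

lemma orbit_generated_subgroup:
  assumes "set \<sigma> \<subseteq> carrier (sym_group n)" "x \<in> {1..n}"
  shows "orbit (generated_subgroup n \<sigma>) (\<lambda>g. restrict g {1..n}) x = orb (set \<sigma>) x"
proof -
  interpret group "sym_group n" by (rule sym_group_is_group)
  have perm: "s permutes {1..n}" if "s \<in> set \<sigma>" for s
    using that assms by (auto simp: sym_group_carrier)
  have "g y \<in> orb (set \<sigma>) y" if "g \<in> generate (sym_group n) (set \<sigma>)" "y \<in> {1..n}" for g y
    using that
  proof (induction arbitrary: y)
    case one
    then show ?case by (simp add: sym_group_one orb.self)
  next
    case (incl s)
    then show ?case using orb.step[OF orb.self] by fast
  next
    case (inv s)
    \<comment> \<open>Inverses are where finiteness enters: \<open>s\<close> permutes the orbit of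
      \<open>y\<close>, so the preimage of \<open>y\<close> under \<open>s\<close> lies in
      it.\<close>
    have "s ` orb (set \<sigma>) y = orb (set \<sigma>) y" using inv perm by (intro image_orb[of "{1..n}"]) auto
    then obtain z where "y = s z" "z \<in> orb (set \<sigma>) y" using orb.self[of y "set \<sigma>"] by blast
    moreover have "(inv\<^bsub>sym_group n\<^esub> s) (s z) = z"
      using inv perm assms l_inv[of s] by (simp add: subset_iff sym_group_def fun_eq_iff)
    ultimately show ?case by simp
  next
    case (eng g h)
    \<comment> \<open>The induction leaves the point arbitrary so that the hypothesis for
      \<open>g\<close> applies at \<open>h y\<close>.\<close>
    have "h y \<in> {1..n}" using orb_subset[of "set \<sigma>" "{1..n}" y] perm eng by blast
    then have "g (h y) \<in> orb (set \<sigma>) (h y)" using eng by blast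
    then show ?case using orb_trans[OF eng.IH(2)[OF eng.prems]] by (auto simp: sym_group_mult)
  qed
  moreover have "\<exists>g \<in> generate (sym_group n) (set \<sigma>). y = g x" if "y \<in> orb (set \<sigma>) x" for y
    using that
  proof induction
    case self
    have "id \<in> generate (sym_group n) (set \<sigma>)" using generate.one[of "sym_group n"] by (simp add: sym_group_one)
    then show ?case by (auto intro: bexI[of _ id])
  next
    case (step y s)
    then obtain g where g: "g \<in> generate (sym_group n) (set \<sigma>)" "y = g x" by auto
    then have "s \<otimes>\<^bsub>sym_group n\<^esub> g \<in> generate (sym_group n) (set \<sigma>)"
      using step generate.incl generate.eng by metis
    then show ?case using g by (auto simp: sym_group_mult intro: bexI[of _ "s \<circ> g"])
  qed
  ultimately show ?thesis using assms(2) by (fastforce simp: orbit_def generated_subgroup_def)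
qed

text \<open>From here on the counts are handled through \<open>tuples\<close>, without the group
  structure.\<close>

lemma commuting_orbit_count_eq: "commuting_orbit_count p n k = card (tuples p {1..n} k)"
proof -
  have orbs: "orbits (generated_subgroup n \<sigma>) {1..n} (\<lambda>g. restrict g {1..n}) = orb (set \<sigma>) ` {1..n}"
    if "set \<sigma> \<subseteq> carrier (sym_group n)" for \<sigma>
    unfolding orbits_def setcompr_eq_image Collect_mem_eq
    using orbit_generated_subgroup[OF that] by (rule image_cong[OF refl])
  have sym: "set \<sigma> \<subseteq> carrier (sym_group n) \<longleftrightarrow> (\<forall>s\<in>set \<sigma>. s permutes {1..n})" for \<sigma>
    by (auto simp: sym_group_carrier)
  have comm: "(\<forall>i<length \<sigma>. \<forall>j<length \<sigma>. \<sigma> ! i \<circ> \<sigma> ! j = \<sigma> ! j \<circ> \<sigma> ! i) \<longleftrightarrow>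
      (\<forall>s\<in>set \<sigma>. \<forall>t\<in>set \<sigma>. s \<circ> t = t \<circ> s)" for \<sigma> :: "(nat \<Rightarrow> nat) list"
    by (simp add: all_set_conv_all_nth)
  have "{\<sigma> \<in> commuting_tuples p n.
    card (orbits (generated_subgroup n \<sigma>) {1..n} (\<lambda>g. restrict g {1..n})) = k} = tuples p {1..n} k"
    unfolding tuples_def
  proof (rule Collect_cong)
    fix \<sigma>
    show "\<sigma> \<in> commuting_tuples p n \<and>
        card (orbits (generated_subgroup n \<sigma>) {1..n} (\<lambda>g. restrict g {1..n})) = k \<longleftrightarrow>
      length \<sigma> = p \<and> (\<forall>s\<in>set \<sigma>. s permutes {1..n}) \<and>
        (\<forall>s\<in>set \<sigma>. \<forall>t\<in>set \<sigma>. s \<circ> t = t \<circ> s) \<and> card (orb (set \<sigma>) ` {1..n}) = k"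
    proof (cases "set \<sigma> \<subseteq> carrier (sym_group n) \<and> length \<sigma> = p")
      case True
      then show ?thesis
        using orbs[of \<sigma>] comm[of \<sigma>] sym[of \<sigma>]
        by (simp add: commuting_tuples_def sym_group_mult)
    next
      case False
      then show ?thesis using sym[of \<sigma>] by (auto simp: commuting_tuples_def)
    qed
  qed
  then show ?thesis by (simp add: commuting_orbit_count_def)
qed

subsection \<open>The recurrence\<close>

lemma sum_Pow_card:
  assumes "finite A"
  shows "(\<Sum>U\<in>Pow A. f (card U)) = (\<Sum>r\<le>card A. (card A choose r) * f r)"
proof -
  have "(\<Sum>U\<in>Pow A. f (card U)) = (\<Sum>r\<le>card A. \<Sum>U | U \<in> Pow A \<and> card U = r. f (card U))"
    using assms by (intro sum.group[symmetric]) (auto simp: card_mono)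
  also have "\<dots> = (\<Sum>r\<le>card A. (card A choose r) * f r)"
    using n_subsets[OF assms] by (intro sum.cong) auto
  finally show ?thesis .
qed

text \<open>The marked point is \<open>Suc n\<close>. Its orbit is \<open>insert (Suc n) U\<close>
  for a set \<open>U\<close> of \<open>r\<close> companions, and both factors depend only on
  \<open>r\<close> by relabelling, so grouping by \<open>r\<close> gives the binomial
  weights.\<close>

lemma commuting_orbit_count_Suc:
  "commuting_orbit_count p (Suc n) (Suc k) = (\<Sum>r\<le>n. (n choose r) *
    (commuting_orbit_count p (Suc r) 1 * commuting_orbit_count p (n - r) k))"
proof -
  have card_eq: "card (tuples p S j) = commuting_orbit_count p (card S) j" if "finite S" for S :: "nat set" and j
    using that by (simp add: commuting_orbit_count_eq card_tuples_cong[of S "{1..card S}"])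
  have sets: "{S. Suc n \<in> S \<and> S \<subseteq> {1..Suc n}} = insert (Suc n) ` Pow {1..n}"
  proof
    show "{S. Suc n \<in> S \<and> S \<subseteq> {1..Suc n}} \<subseteq> insert (Suc n) ` Pow {1..n}"
    proof
      fix S assume S: "S \<in> {S. Suc n \<in> S \<and> S \<subseteq> {1..Suc n}}"
      then have "S = insert (Suc n) (S - {Suc n})" by auto
      moreover have "S - {Suc n} \<in> Pow {1..n}" using S by (auto simp: le_Suc_eq)
      ultimately show "S \<in> insert (Suc n) ` Pow {1..n}" by blast
    qed
  qed auto
  have inj: "inj_on (insert (Suc n)) (Pow {1..n})"
  proof (rule inj_onI)
    fix U V assume UV: "U \<in> Pow {1..n}" "V \<in> Pow {1..n}" "insert (Suc n) U = insert (Suc n) V"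
    then have "Suc n \<notin> U" "Suc n \<notin> V" by auto
    then show "U = V" using UV(3) by (simp add: insert_ident)
  qed
  have "commuting_orbit_count p (Suc n) (Suc k) =
      (\<Sum>S | Suc n \<in> S \<and> S \<subseteq> {1..Suc n}. card (tuples p S 1) * card (tuples p ({1..Suc n} - S) k))"
    unfolding commuting_orbit_count_eq by (rule card_tuples_Suc) auto
  also have "\<dots> = (\<Sum>U\<in>Pow {1..n}. card (tuples p (insert (Suc n) U) 1) *
      card (tuples p ({1..Suc n} - insert (Suc n) U) k))"
    unfolding sets by (rule sum.reindex_cong[OF inj refl refl])
  also have "\<dots> = (\<Sum>U\<in>Pow {1..n}. commuting_orbit_count p (Suc (card U)) 1 *
      commuting_orbit_count p (n - card U) k)"
  proof (intro sum.cong refl)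
    fix U assume U: "U \<in> Pow {1..n}"
    then have fin: "finite U" "Suc n \<notin> U" using finite_subset[of U "{1..n}"] by auto
    have "{1..Suc n} - insert (Suc n) U = {1..n} - U" by (auto simp: le_Suc_eq)
    moreover have "card ({1..n} - U) = n - card U" using U fin by (simp add: card_Diff_subset)
    ultimately show "card (tuples p (insert (Suc n) U) 1) *
        card (tuples p ({1..Suc n} - insert (Suc n) U) k) =
        commuting_orbit_count p (Suc (card U)) 1 * commuting_orbit_count p (n - card U) k"
      using fin by (simp add: card_eq)
  qed
  also have "\<dots> = (\<Sum>r\<le>n. (n choose r) *
    (commuting_orbit_count p (Suc r) 1 * commuting_orbit_count p (n - r) k))"
    using sum_Pow_card[of "{1..n}"] by simp
  finally show ?thesis .
qed

section \<open>Boundary values of the counts\<close>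

lemma commuting_orbit_count_eq_0:
  assumes "n < k"
  shows "commuting_orbit_count p n k = 0"
proof -
  have "card (orb F ` {1..n}) \<noteq> k" for F using card_image_le[of "{1..n}" "orb F"] assms by simp
  then have "tuples p {1..n} k = {}" by (auto simp: tuples_def)
  then show ?thesis by (simp add: commuting_orbit_count_eq)
qed

lemma commuting_orbit_count_trivial:
  assumes "n \<le> 1"
  shows "commuting_orbit_count p n n = 1"
proof -
  have X: "{1..n} = {} \<or> {1..n} = {1}" using assms by (cases n) auto
  then have perm: "s permutes {1..n} \<longleftrightarrow> s = id" for s by auto
  have orbs: "card (orb F ` {1..n}) = n" for F using assms by (cases n) auto
  have "tuples p {1..n} n = {replicate p id}"
    unfolding tuples_def perm orbs by (auto simp: replicate_eqI)
  then show ?thesis by (simp add: commuting_orbit_count_eq)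
qed

text \<open>If \<open>Suc n\<close> has \<open>r > 0\<close> companions, the other
  \<open>n - r\<close> points cannot form \<open>n\<close> orbits; only the term
  \<open>r = 0\<close> of the recurrence survives.\<close>

lemma commuting_orbit_count_diag: "commuting_orbit_count p n n = 1"
proof (induction n)
  case (Suc n)
  have "commuting_orbit_count p (Suc n) (Suc n) = (\<Sum>r\<in>{0}. (n choose r) *
    (commuting_orbit_count p (Suc r) 1 * commuting_orbit_count p (n - r) n))"
    unfolding commuting_orbit_count_Suc
    by (rule sum.mono_neutral_right) (auto intro!: commuting_orbit_count_eq_0)
  then show ?case using Suc commuting_orbit_count_trivial[of 1 p] by simp
qed (simp add: commuting_orbit_count_trivial)

text \<open>The constant tuple of the transposition is transitive. Positivity keeps the limits below
  from degenerating to zero.\<close>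

lemma commuting_orbit_count_2_1_pos:
  assumes "p \<ge> 1"
  shows "commuting_orbit_count p 2 1 > 0"
proof -
  define t :: "nat \<Rightarrow> nat" where "t = transpose 1 2"
  have t: "t permutes {1..2}" unfolding t_def by (rule permutes_swap_id) auto
  have "t 1 \<in> orb {t} 1" by (intro orb.step[OF orb.self]) auto
  moreover have "t 1 = 2" "{1..2::nat} = {1, 2}" by (auto simp: t_def)
  ultimately have "{1..2} \<subseteq> orb {t} 1" using orb.self[of 1 "{t}"] by simp
  moreover have "orb {t} 1 \<subseteq> {1..2}" using t by (intro orb_subset) auto
  ultimately have "card (orb {t} ` {1..2}) = 1"
    using card_orbs_eq_1_iff[of "{1..2}" "{t}" 1] t by auto
  then have "replicate p t \<in> tuples p {1..2} 1" using assms t by (auto simp: tuples_def)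
  then show ?thesis using finite_tuples[of "{1..2::nat}" p 1]
    by (auto simp: commuting_orbit_count_eq card_gt_0_iff)
qed

section \<open>Counting by corank\<close>

text \<open>This is the function \<open>D\<^sub>a(n)\<close> of the overview. Subtraction truncates,
  so only values with \<open>a \<le> n\<close> have the intended meaning.\<close>

definition corank_count :: "nat \<Rightarrow> nat \<Rightarrow> nat \<Rightarrow> nat"
  where "corank_count p a n = commuting_orbit_count p n (n - a)"

lemma corank_count_0: "corank_count p 0 n = 1"
  by (simp add: corank_count_def commuting_orbit_count_diag)

lemma corank_count_Suc:
  assumes "a \<le> n"
  shows "corank_count p a (Suc n) = corank_count p a n + (\<Sum>r=1..a. (n choose r) *
    (commuting_orbit_count p (Suc r) 1 * corank_count p (a - r) (n - r)))"
proof -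
  let ?f = "\<lambda>r. (n choose r) * (commuting_orbit_count p (Suc r) 1 * commuting_orbit_count p (n - r) (n - a))"
  have "corank_count p a (Suc n) = (\<Sum>r\<le>n. ?f r)"
    unfolding corank_count_def Suc_diff_le[OF assms] by (rule commuting_orbit_count_Suc)
  also have "\<dots> = (\<Sum>r=0..a. ?f r)"
    \<comment> \<open>For \<open>r > a\<close> fewer than \<open>n - a\<close> points remain, so
      these terms vanish.\<close>
    using assms by (intro sum.mono_neutral_right) (auto intro!: commuting_orbit_count_eq_0)
  also have "\<dots> = (\<Sum>r=0..a. (n choose r) * (commuting_orbit_count p (Suc r) 1 * corank_count p (a - r) (n - r)))"
    using assms by (intro sum.cong) (auto simp: corank_count_def)
  also have "\<dots> = corank_count p a n + (\<Sum>r=1..a. (n choose r) *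
    (commuting_orbit_count p (Suc r) 1 * corank_count p (a - r) (n - r)))"
    \<comment> \<open>The term \<open>r = 0\<close>, in which \<open>Suc n\<close> is a common fixed
      point, yields \<open>corank_count p a n\<close>.\<close>
    by (subst sum.atLeast_Suc_atMost) (auto simp: commuting_orbit_count_diag[of p 1, simplified])
  finally show ?thesis .
qed

subsection \<open>Asymptotics\<close>

text \<open>Past some index the increments of \<open>x - L * y\<close> are at most
  \<open>e / 2\<close> times those of \<open>y\<close>. Telescoping bounds \<open>x - L * y\<close>
  by \<open>e / 2 * y\<close> plus a constant, which the divergence of \<open>y\<close>
  absorbs.\<close>

lemma Stolz_Cesaro:
  fixes x y :: "nat \<Rightarrow> real"
  assumes y: "filterlim y at_top sequentially" and mono: "eventually (\<lambda>n. y n < y (Suc n)) sequentially"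
    and lim: "(\<lambda>n. (x (Suc n) - x n) / (y (Suc n) - y n)) \<longlonglongrightarrow> L"
  shows "(\<lambda>n. x n / y n) \<longlonglongrightarrow> L"
proof (rule LIMSEQ_I)
  fix e :: real assume e: "e > 0"
  define z where "z n = x n - L * y n" for n
  have "eventually (\<lambda>n. \<bar>(x (Suc n) - x n) / (y (Suc n) - y n) - L\<bar> < e / 2) sequentially"
    using lim e by (auto simp: tendsto_iff dist_real_def dest: spec[of _ "e / 2"])
  then have "eventually (\<lambda>n. \<bar>z (Suc n) - z n\<bar> \<le> e / 2 * (y (Suc n) - y n)) sequentially"
    using mono
  proof eventually_elim
    case (elim n)
    have "z (Suc n) - z n = ((x (Suc n) - x n) / (y (Suc n) - y n) - L) * (y (Suc n) - y n)"
      using elim by (simp add: z_def field_simps)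
    then show ?case using elim by (simp add: abs_mult mult_right_mono less_imp_le)
  qed
  then obtain N where N: "\<And>n. n \<ge> N \<Longrightarrow> \<bar>z (Suc n) - z n\<bar> \<le> e / 2 * (y (Suc n) - y n)"
    by (auto simp: eventually_sequentially)
  have bound: "\<bar>z n - z N\<bar> \<le> e / 2 * (y n - y N)" if "n \<ge> N" for n
    using that
  proof (induction n rule: dec_induct)
    case (step n)
    have "\<bar>z (Suc n) - z N\<bar> \<le> \<bar>z n - z N\<bar> + \<bar>z (Suc n) - z n\<bar>" by linarith
    also have "\<dots> \<le> e / 2 * (y n - y N) + e / 2 * (y (Suc n) - y n)"
      using step N[of n] by (intro add_mono) auto
    also have "\<dots> = e / 2 * (y (Suc n) - y N)" by (simp add: field_simps)
    finally show ?case .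
  qed simp
  \<comment> \<open>Beyond \<open>M\<close>, \<open>y n\<close> is positive and the leftover
    constant is below \<open>e / 2 * y n\<close>.\<close>
  define M where "M = max 0 (2 / e * (\<bar>z N\<bar> - e / 2 * y N))"
  have "eventually (\<lambda>n. y n > M \<and> n \<ge> N) sequentially"
    using y by (auto simp: filterlim_at_top_dense eventually_conj_iff eventually_ge_at_top)
  then have "eventually (\<lambda>n. norm (x n / y n - L) < e) sequentially"
  proof eventually_elim
    case (elim n)
    then have yn: "y n > 0" "2 / e * (\<bar>z N\<bar> - e / 2 * y N) < y n" by (auto simp: M_def)
    have "\<bar>z N\<bar> - e / 2 * y N < e / 2 * y n"
      using yn(2) e by (simp add: field_simps)
    moreover have "\<bar>z n - z N\<bar> \<le> e / 2 * y n - e / 2 * y N"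
      using bound[of n] elim by (simp add: right_diff_distrib)
    ultimately have "\<bar>z n\<bar> < e * y n" by linarith
    moreover have "x n / y n - L = z n / y n" using yn by (simp add: z_def field_simps)
    ultimately show ?case using yn by (simp add: abs_divide field_simps)
  qed
  then show "\<exists>no. \<forall>n\<ge>no. norm (x n / y n - L) < e" by (simp add: eventually_sequentially)
qed

lemma tendsto_diff_ratio: "(\<lambda>n. real (n - k) / real n) \<longlonglongrightarrow> 1"
proof (rule Lim_transform_eventually)
  show "(\<lambda>n. 1 - real k / real n) \<longlonglongrightarrow> 1"
    using tendsto_diff[OF tendsto_const lim_const_over_n[of "real k"], of 1] by simp
  show "eventually (\<lambda>n. 1 - real k / real n = real (n - k) / real n) sequentially"
    using eventually_ge_at_top[of "Suc k"] by eventually_elim (auto simp: field_simps of_nat_diff)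
qed

lemma tendsto_choose_ratio: "(\<lambda>n. real (n choose k) / real n ^ k) \<longlonglongrightarrow> 1 / fact k"
proof (induction k)
  case (Suc k)
  have "real (n choose Suc k) = real (n choose k) * real (n - k) / real (Suc k)" for n
  proof -
    \<comment> \<open>Truncation is harmless here: for \<open>n < k\<close> both sides are
      zero.\<close>
    have "Suc k * (n choose Suc k) = (n - k) * (n choose k)"
      using binomial_absorption[of k n] binomial_absorb_comp[of n k] by simp
    then have "real (Suc k) * real (n choose Suc k) = real (n - k) * real (n choose k)"
      by (metis of_nat_mult)
    then show ?thesis by (simp add: field_simps)
  qed
  then have eq: "real (n choose Suc k) / real n ^ Suc k =
      real (n choose k) / real n ^ k * (real (n - k) / real n) / real (Suc k)" for n
    by simp
  have "(\<lambda>n. real (n choose k) / real n ^ k * (real (n - k) / real n) / real (Suc k))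
      \<longlonglongrightarrow> 1 / fact k * 1 / real (Suc k)"
    by (intro tendsto_intros Suc tendsto_diff_ratio) simp
  then show ?case unfolding eq by (simp add: field_simps)
qed simp

lemma filterlim_choose_at_top:
  assumes "k > 0"
  shows "filterlim (\<lambda>n. real (n choose k)) at_top sequentially"
proof -
  have "filterlim (\<lambda>n. real n ^ k) at_top sequentially"
    using assms by (intro filterlim_pow_at_top filterlim_real_sequentially)
  then have "filterlim (\<lambda>n. real (n choose k) / real n ^ k * real n ^ k) at_top sequentially"
    by (intro filterlim_tendsto_pos_mult_at_top[OF tendsto_choose_ratio]) auto
  moreover have "eventually (\<lambda>n. real (n choose k) / real n ^ k * real n ^ k = real (n choose k)) sequentially"
    using eventually_gt_at_top[of 0] by eventually_elim simp
  ultimately show ?thesis by (simp cong: filterlim_cong)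
qed

text \<open>Needed because the recurrence evaluates smaller coranks at \<open>n - r\<close>; the
  correction factor \<open>((n - r) / n) ^ m\<close> tends to 1.\<close>

lemma tendsto_shift_power_ratio:
  assumes "(\<lambda>n. f n / real n ^ m) \<longlonglongrightarrow> L"
  shows "(\<lambda>n. f (n - r) / real n ^ m) \<longlonglongrightarrow> L"
proof (rule Lim_transform_eventually)
  have "(\<lambda>n. f (n - r) / real (n - r) ^ m) \<longlonglongrightarrow> L"
    using assms filterlim_minus_const_nat_at_top by (rule filterlim_compose)
  then show "(\<lambda>n. f (n - r) / real (n - r) ^ m * (real (n - r) / real n) ^ m) \<longlonglongrightarrow> L"
    using tendsto_mult[OF _ tendsto_power[OF tendsto_diff_ratio]] by fastforce
  show "eventually (\<lambda>n. f (n - r) / real (n - r) ^ m * (real (n - r) / real n) ^ m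
      = f (n - r) / real n ^ m) sequentially"
    using eventually_gt_at_top[of r] by eventually_elim (simp add: power_divide)
qed

text \<open>By the induction hypothesis the summand \<open>r\<close> of the increment has order at
  most \<open>r + 2 * (a - r) = 2 * a - r\<close>. After division by \<open>n ^ (2 * a - 1)\<close>
  only \<open>r = 1\<close> contributes to the limit.\<close>

lemma tendsto_corank_count:
  "(\<lambda>n. real (corank_count p a n) / real n ^ (2 * a))
    \<longlonglongrightarrow> (real (commuting_orbit_count p 2 1) / 2) ^ a / fact a"
proof (induction a rule: less_induct)
  case (less a)
  define t where "t r = real (commuting_orbit_count p (Suc r) 1)" for r
  define L where "L b = (t 1 / 2) ^ b / fact b" for b
  have IH: "(\<lambda>n. real (corank_count p b n) / real n ^ (2 * b)) \<longlonglongrightarrow> L b" if "b < a" for b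
    using less[OF that] by (simp add: L_def t_def numeral_2_eq_2)
  have "(\<lambda>n. real (corank_count p a n) / real n ^ (2 * a)) \<longlonglongrightarrow> L a"
  proof (cases a)
    case 0
    then show ?thesis by (simp add: corank_count_0 L_def)
  next
    case (Suc b)
    \<comment> \<open>With \<open>a = Suc b\<close>, the exponent \<open>2 * b + 1\<close> below is
      \<open>2 * a - 1\<close>.\<close>
    define x where "x n = real (corank_count p a n)" for n
    have "(\<lambda>n. real (n choose r) * (t r * real (corank_count p (a - r) (n - r))) / real n ^ (2 * b + 1))
        \<longlonglongrightarrow> (if r = 1 then t 1 * L b else 0)" if r: "r \<in> {1..a}" for r
    proof (rule Lim_transform_eventually)
      have inv: "(\<lambda>n. (1 / real n) ^ (r - 1)) \<longlonglongrightarrow> (if r = 1 then 1 else 0)"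
      proof (cases "r = 1")
        case False
        have "(\<lambda>n. (1 / real n) ^ (r - 1)) \<longlonglongrightarrow> 0 ^ (r - 1)"
          by (intro tendsto_power lim_1_over_n)
        then show ?thesis using False r by (simp add: power_0_left)
      qed simp
      have "(\<lambda>n. real (corank_count p (a - r) (n - r)) / real n ^ (2 * (a - r))) \<longlonglongrightarrow> L (a - r)"
        using IH[of "a - r"] r by (intro tendsto_shift_power_ratio) auto
      then have "(\<lambda>n. real (n choose r) / real n ^ r * (t r * (real (corank_count p (a - r) (n - r)) /
          real n ^ (2 * (a - r)))) * (1 / real n) ^ (r - 1))
        \<longlonglongrightarrow> 1 / fact r * (t r * L (a - r)) * (if r = 1 then 1 else 0)"
        by (intro tendsto_mult tendsto_choose_ratio tendsto_const inv)
      also have "1 / fact r * (t r * L (a - r)) * (if r = 1 then 1 else 0) =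
          (if r = 1 then t 1 * L b else 0)"
        using Suc by auto
      finally show "(\<lambda>n. real (n choose r) / real n ^ r * (t r * (real (corank_count p (a - r) (n - r)) /
          real n ^ (2 * (a - r)))) * (1 / real n) ^ (r - 1))
        \<longlonglongrightarrow> (if r = 1 then t 1 * L b else 0)"
        .
      \<comment> \<open>The surplus \<open>r - 1\<close> supplies the factor
        \<open>(1 / n) ^ (r - 1)\<close>, which vanishes in the limit unless
        \<open>r = 1\<close>.\<close>
      have "r + 2 * (a - r) + (r - 1) = 2 * b + 1" using r Suc by auto
      then have "real n ^ (2 * b + 1) = real n ^ r * real n ^ (2 * (a - r)) * real n ^ (r - 1)" for n
        by (metis power_add)
      then show "eventually (\<lambda>n. real (n choose r) / real n ^ r * (t r * (real (corank_count p (a - r) (n - r)) /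
          real n ^ (2 * (a - r)))) * (1 / real n) ^ (r - 1) =
          real (n choose r) * (t r * real (corank_count p (a - r) (n - r))) / real n ^ (2 * b + 1)) sequentially"
        by (simp add: power_divide)
    qed
    then have "(\<lambda>n. \<Sum>r=1..a. real (n choose r) * (t r * real (corank_count p (a - r) (n - r))) / real n ^ (2 * b + 1))
        \<longlonglongrightarrow> (\<Sum>r=1..a. if r = 1 then t 1 * L b else 0)"
      by (rule tendsto_sum)
    also have "(\<Sum>r=1..a. if r = 1 then t 1 * L b else 0) = t 1 * L b"
      using Suc by (subst sum.delta) auto
    finally have sum: "(\<lambda>n. \<Sum>r=1..a. real (n choose r) *
        (t r * real (corank_count p (a - r) (n - r))) / real n ^ (2 * b + 1)) \<longlonglongrightarrow> t 1 * L b" .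
    have "(\<lambda>n. (x (Suc n) - x n) / real n ^ (2 * b + 1)) \<longlonglongrightarrow> t 1 * L b"
    proof (rule Lim_transform_eventually[OF sum])
      show "eventually (\<lambda>n. (\<Sum>r=1..a. real (n choose r) * (t r * real (corank_count p (a - r) (n - r))) / real n ^ (2 * b + 1))
          = (x (Suc n) - x n) / real n ^ (2 * b + 1)) sequentially"
        using eventually_ge_at_top[of a]
        by eventually_elim (simp add: x_def t_def corank_count_Suc sum_divide_distrib)
    qed
    \<comment> \<open>Stolz--Cesaro is applied against \<open>C(n, 2b + 2)\<close>, whose differences are \<open>C(n, 2b + 1)\<close>.\<close>
    then have "(\<lambda>n. (x (Suc n) - x n) / real n ^ (2 * b + 1) / (real (n choose (2 * b + 1)) / real n ^ (2 * b + 1)))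
        \<longlonglongrightarrow> t 1 * L b / (1 / fact (2 * b + 1))"
      by (intro tendsto_divide tendsto_choose_ratio) auto
    moreover have "eventually (\<lambda>n. (x (Suc n) - x n) / real n ^ (2 * b + 1) / (real (n choose (2 * b + 1)) / real n ^ (2 * b + 1))
        = (x (Suc n) - x n) / (real (Suc n choose (2 * b + 2)) - real (n choose (2 * b + 2)))) sequentially"
      using eventually_gt_at_top[of 0] by eventually_elim simp
    ultimately have "(\<lambda>n. (x (Suc n) - x n) / (real (Suc n choose (2 * b + 2)) - real (n choose (2 * b + 2))))
        \<longlonglongrightarrow> t 1 * L b / (1 / fact (2 * b + 1))"
      by (rule Lim_transform_eventually)
    then have "(\<lambda>n. x n / real (n choose (2 * b + 2))) \<longlonglongrightarrow> t 1 * L b / (1 / fact (2 * b + 1))"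
    proof (rule Stolz_Cesaro[rotated 2])
      show "filterlim (\<lambda>n. real (n choose (2 * b + 2))) at_top sequentially"
        by (rule filterlim_choose_at_top) simp
      show "eventually (\<lambda>n. real (n choose (2 * b + 2)) < real (Suc n choose (2 * b + 2))) sequentially"
        using eventually_ge_at_top[of "2 * b + 1"] by eventually_elim (simp add: zero_less_binomial)
    qed
    \<comment> \<open>Return from the binomial scale to the power
      \<open>n ^ (2 * a)\<close>.\<close>
    then have "(\<lambda>n. x n / real (n choose (2 * b + 2)) * (real (n choose (2 * b + 2)) / real n ^ (2 * b + 2)))
        \<longlonglongrightarrow> t 1 * L b / (1 / fact (2 * b + 1)) * (1 / fact (2 * b + 2))"
      by (intro tendsto_mult tendsto_choose_ratio)
    moreover have "eventually (\<lambda>n. x n / real (n choose (2 * b + 2)) * (real (n choose (2 * b + 2)) / real n ^ (2 * b + 2))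
        = real (corank_count p a n) / real n ^ (2 * a)) sequentially"
      using eventually_ge_at_top[of "2 * b + 2"]
      by eventually_elim (use Suc in \<open>simp add: x_def\<close>)
    ultimately have "(\<lambda>n. real (corank_count p a n) / real n ^ (2 * a))
        \<longlonglongrightarrow> t 1 * L b / (1 / fact (2 * b + 1)) * (1 / fact (2 * b + 2))"
      by (rule Lim_transform_eventually)
    moreover have "t 1 * L b / (1 / fact (2 * b + 1)) * (1 / fact (2 * b + 2)) = L a"
    proof -
      have "fact (2 * b + 2) = real (2 * b + 2) * fact (2 * b + 1)" by (simp add: algebra_simps)
      then have "t 1 * L b / (1 / fact (2 * b + 1)) * (1 / fact (2 * b + 2)) = t 1 * L b / real (2 * b + 2)"
        by simp
      also have "\<dots> = L a" using Suc by (simp add: L_def field_simps)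
      finally show ?thesis .
    qed
    ultimately show ?thesis by simp
  qed
  then show ?case by (simp add: L_def t_def numeral_2_eq_2)
qed

text \<open>The three counts have coranks \<open>\<alpha> + 1\<close>, \<open>\<alpha>\<close> and
  \<open>\<alpha> - 1\<close>. Both sides of the inequality are normalized by
  \<open>n ^ (4 * \<alpha>)\<close>, so a strict inequality between the limits carries over to large
  \<open>n\<close>.\<close>

theorem theorem1p1:
  fixes p \<alpha> :: nat
  assumes "p \<ge> 2" and "\<alpha> \<ge> 1"
  shows "\<exists>N \<ge> \<alpha> + 2. \<forall>n \<ge> N. \<forall>k. k = n - \<alpha> \<longrightarrow>
    (commuting_orbit_count p n k)\<^sup>2 \<ge> commuting_orbit_count p n (k - 1) * commuting_orbit_count p n (k + 1)"
proof -
  obtain b where b: "\<alpha> = Suc b" using assms(2) by (cases \<alpha>) auto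
  define c where "c = real (commuting_orbit_count p 2 1) / 2"
  have c: "c > 0" using commuting_orbit_count_2_1_pos[of p] assms(1) by (simp add: c_def)
  define R where "R a n = real (corank_count p a n) / real n ^ (2 * a)" for a n
  have R: "R a \<longlonglongrightarrow> c ^ a / fact a" for a
    unfolding R_def c_def by (rule tendsto_corank_count)
  \<comment> \<open>The quotient of the two sides is \<open>\<alpha> / (\<alpha> + 1)\<close>,
    whatever the value of \<open>c\<close>.\<close>
  have "c ^ (\<alpha> + 1) / fact (\<alpha> + 1) * (c ^ b / fact b) < (c ^ \<alpha> / fact \<alpha>)\<^sup>2"
  proof -
    have "c ^ (\<alpha> + 1) / fact (\<alpha> + 1) = c ^ \<alpha> / fact \<alpha> * (c / real (\<alpha> + 1))" by (simp add: mult_ac)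
    moreover have "c ^ b / fact b = c ^ \<alpha> / fact \<alpha> * (real \<alpha> / c)" using c by (simp add: b)
    ultimately have "c ^ (\<alpha> + 1) / fact (\<alpha> + 1) * (c ^ b / fact b) =
        c ^ \<alpha> / fact \<alpha> * (c / real (\<alpha> + 1)) * (c ^ \<alpha> / fact \<alpha> * (real \<alpha> / c))"
      by (simp only:)
    also have "\<dots> = (c ^ \<alpha> / fact \<alpha>)\<^sup>2 * (real \<alpha> / real (\<alpha> + 1))"
      using c by (simp add: power2_eq_square mult_ac)
    also have "\<dots> < (c ^ \<alpha> / fact \<alpha>)\<^sup>2 * 1"
      using c by (intro mult_strict_left_mono) auto
    finally show ?thesis by simp
  qed
  then have "0 < (c ^ \<alpha> / fact \<alpha>)\<^sup>2 - c ^ (\<alpha> + 1) / fact (\<alpha> + 1) * (c ^ b / fact b)" by simp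
  moreover have "(\<lambda>n. (R \<alpha> n)\<^sup>2 - R (\<alpha> + 1) n * R b n)
      \<longlonglongrightarrow> (c ^ \<alpha> / fact \<alpha>)\<^sup>2 - c ^ (\<alpha> + 1) / fact (\<alpha> + 1) * (c ^ b / fact b)"
    by (intro tendsto_intros R)
  ultimately have "eventually (\<lambda>n. 0 < (R \<alpha> n)\<^sup>2 - R (\<alpha> + 1) n * R b n) sequentially"
    by (rule order_tendstoD(1)[rotated])
  then obtain M where M: "\<And>n. n \<ge> M \<Longrightarrow> 0 < (R \<alpha> n)\<^sup>2 - R (\<alpha> + 1) n * R b n"
    by (auto simp: eventually_sequentially)
  have main: "corank_count p (\<alpha> + 1) n * corank_count p b n \<le> (corank_count p \<alpha> n)\<^sup>2"
    if n: "n \<ge> M" "n \<ge> 1" for n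
  proof -
    have pos: "real n ^ (4 * \<alpha>) > 0" using n by simp
    have "2 * (\<alpha> + 1) + 2 * b = 4 * \<alpha>" using b by simp
    then have "real n ^ (2 * (\<alpha> + 1)) * real n ^ (2 * b) = real n ^ (4 * \<alpha>)"
      by (metis power_add)
    then have "R (\<alpha> + 1) n * R b n =
        real (corank_count p (\<alpha> + 1) n * corank_count p b n) / real n ^ (4 * \<alpha>)"
      by (simp add: R_def del: power_Suc)
    moreover have "(R \<alpha> n)\<^sup>2 = real ((corank_count p \<alpha> n)\<^sup>2) / real n ^ (4 * \<alpha>)"
      by (simp add: R_def power_divide flip: power_mult)
    ultimately have "real (corank_count p (\<alpha> + 1) n * corank_count p b n) / real n ^ (4 * \<alpha>)
        < real ((corank_count p \<alpha> n)\<^sup>2) / real n ^ (4 * \<alpha>)"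
      using M[OF n(1)] by linarith
    then have "real (corank_count p (\<alpha> + 1) n * corank_count p b n) < real ((corank_count p \<alpha> n)\<^sup>2)"
      using pos by (simp only: divide_less_cancel)
    then show ?thesis by linarith
  qed
  show ?thesis
  \<comment> \<open>The bound \<open>\<alpha> + 2\<close> gives \<open>k \<ge> 2\<close>, so
    \<open>k - 1\<close> is a genuine positive number of orbits.\<close>
  proof (intro exI[of _ "max M (\<alpha> + 2)"] conjI allI impI)
    fix n k assume n: "n \<ge> max M (\<alpha> + 2)" and k: "k = n - \<alpha>"
    have "k - 1 = n - (\<alpha> + 1)" "k + 1 = n - b" using n k b by auto
    then show "(commuting_orbit_count p n k)\<^sup>2 \<ge>
        commuting_orbit_count p n (k - 1) * commuting_orbit_count p n (k + 1)"
      using main[of n] n k by (simp add: corank_count_def)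
  qed simp
qed

end
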